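(* Fix $m \in \mathbb{N}$, $n \in \mathbb{N}$ with $n \ge 3$, and $N \in \mathbb{N}$. Then for all sufficiently large $N' \in \mathbb{N}$ (i.e. there exists $N'_0 = N'_0(m,n,N)$ such that for all $N' \ge N'_0$), the estimator $\tilde{\boldsymbol p}$ is dominated by the estimator $\hat{\boldsymbol p}$ under the entropy loss $L$.
   Context: Here $\mathbb{N} = \{1,2,\dots\}$. Parameter space: $\Theta = \{ ((p_{i,j})_{j=0}^{n})_{i=0}^{m} \in (0,\infty)^{(1+m)(1+n)} : \sum_{i=0}^{m}\sum_{j=0}^{n} p_{i,j} = 1 \}$; the unknown parameter is $\boldsymbol p = ((p_{i,j})_{j=0}^{n})_{i=0}^{m} \in \Theta$. Observations: $\boldsymbol X = ((X_{i,j})_{j=0}^{n})_{i=0}^{m}$ is multinomial with $N$ trials and cell probabilities $\boldsymbol p$. Independently of $\boldsymbol X$, $\boldsymbol Y^* = ((Y^*_{i,j})_{j=0}^{n})_{i=0}^{m}$ is multinomial with $N'$ trials and cell probabilities $\boldsymbol p$, and only the row totals $\boldsymbol Y = (Y_i)_{i=0}^{m}$, $Y_i = \sum_{j=0}^{n} Y^*_{i,j}$, are observed (so $\boldsymbol Y$ is multinomial with $N'$ trials and cell probabilities $(\sum_{j=0}^{n} p_{i,j})_{i=0}^{m}$). Write $X_{i,\cdot} = \sum_{j=0}^{n} X_{i,j}$. Entropy loss: $L(\boldsymbol d, \boldsymbol p) = \sum_{i=0}^{m}\sum_{j=0}^{n} p_{i,j} \log (p_{i,j}/d_{i,j})$ for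 $\boldsymbol d, \boldsymbol p \in \Theta$. Estimators (the Bayes estimators under the Jeffreys prior based on $\boldsymbol X$ and on $(\boldsymbol X, \boldsymbol Y)$, respectively): $$\tilde p_{i,j} = \frac{X_{i,j} + 1/2}{N + (1+m)(1+n)/2}, \qquad \hat p_{i,j} = \frac{X_{i,\cdot} + Y_i + (1+n)/2}{N + N' + (1+m)(1+n)/2}\cdot\frac{X_{i,j}+1/2}{X_{i,\cdot} + (1+n)/2},$$ with $\tilde{\boldsymbol p} = ((\tilde p_{i,j})_{j=0}^{n})_{i=0}^{m}$ and $\hat{\boldsymbol p} = ((\hat p_{i,j})_{j=0}^{n})_{i=0}^{m}$. Dominance: $\tilde{\boldsymbol p}$ is dominated by $\hat{\boldsymbol p}$ if $E_{\boldsymbol p}[L(\hat{\boldsymbol p}, \boldsymbol p)] \le E_{\boldsymbol p}[L(\tilde{\boldsymbol p}, \boldsymbol p)]$ for all $\boldsymbol p \in \Theta$, with strict inequality for at least one $\boldsymbol p \in \Theta$, where $E_{\boldsymbol p}$ is expectation over the joint law of $(\boldsymbol X, \boldsymbol Y)$ under $\boldsymbol p$. *)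

theory Defs
  imports "HOL-Probability.Probability"
begin

text \<open>
  Multinomial distribution with \<open>N\<close> trials on a finite set \<open>A\<close> of cells with cell probabilities
  \<open>p\<close>. Count vectors are functions on the whole index type that vanish outside \<open>A\<close>.
\<close>

definition count_vectors :: "nat \<Rightarrow> 'a set \<Rightarrow> ('a \<Rightarrow> nat) set" where
  "count_vectors N A = {x. (\<forall>a. a \<notin> A \<longrightarrow> x a = 0) \<and> (\<Sum>a\<in>A. x a) = N}"

definition multinomial_density :: "nat \<Rightarrow> 'a set \<Rightarrow> ('a \<Rightarrow> real) \<Rightarrow> ('a \<Rightarrow> nat) \<Rightarrow> real" where
  "multinomial_density N A p x =
     (if x \<in> count_vectors N A then fact N / (\<Prod>a\<in>A. fact (x a)) * (\<Prod>a\<in>A. p a ^ x a) else 0)"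

definition multinomial_pmf :: "nat \<Rightarrow> 'a set \<Rightarrow> ('a \<Rightarrow> real) \<Rightarrow> ('a \<Rightarrow> nat) pmf" where
  "multinomial_pmf N A p = embed_pmf (multinomial_density N A p)"

lemma count_vectors_insert:
  assumes "finite A" "b \<notin> A"
  shows "bij_betw (\<lambda>(k, x). x(b := k)) (SIGMA k:{..N}. count_vectors (N - k) A)
           (count_vectors N (insert b A))"
proof (rule bij_betwI[where g = "\<lambda>x. (x b, x(b := 0))"])
  have upd: "(\<Sum>a\<in>A. (x(b := k)) a) = (\<Sum>a\<in>A. x a)" for x :: "'a \<Rightarrow> nat" and k
    using assms by (intro sum.cong) auto
  show "(\<lambda>(k, x). x(b := k)) \<in> (SIGMA k:{..N}. count_vectors (N - k) A) \<rightarrow>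
          count_vectors N (insert b A)"
    using assms upd by (auto simp: count_vectors_def simp del: fun_upd_apply) auto
  show "(\<lambda>x. (x b, x(b := 0))) \<in> count_vectors N (insert b A) \<rightarrow>
          (SIGMA k:{..N}. count_vectors (N - k) A)"
    using assms upd by (auto simp: count_vectors_def simp del: fun_upd_apply) auto
qed (use assms in \<open>auto simp: count_vectors_def fun_eq_iff\<close>)

lemma finite_count_vectors: "finite A \<Longrightarrow> finite (count_vectors N A)"
proof (induction A arbitrary: N rule: finite_induct)
  case empty
  have "count_vectors N {} \<subseteq> {\<lambda>_ :: 'a. 0}"
    by (auto simp: count_vectors_def)
  then show ?case by (rule finite_subset) simp
next
  case (insert b A)
  then show ?case
    using bij_betw_finite[OF count_vectors_insert[of A b N]] by (auto intro: finite_SigmaI)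
qed

lemma multinomial_theorem:
  fixes p :: "'a \<Rightarrow> real"
  assumes "finite A"
  shows "(\<Sum>x\<in>count_vectors N A. \<Prod>a\<in>A. p a ^ x a / fact (x a)) = (\<Sum>a\<in>A. p a) ^ N / fact N"
  using assms
proof (induction A arbitrary: N rule: finite_induct)
  case empty
  have "count_vectors N {} = (if N = 0 then {\<lambda>_ :: 'a. 0} else {})"
    by (auto simp: count_vectors_def)
  then show ?case by simp
next
  case (insert b A)
  let ?f = "\<lambda>a k. p a ^ k / fact k"
  have "(\<Sum>x\<in>count_vectors N (insert b A). \<Prod>a\<in>insert b A. ?f a (x a)) =
      (\<Sum>(k, x)\<in>(SIGMA k:{..N}. count_vectors (N - k) A).
         \<Prod>a\<in>insert b A. ?f a ((x(b := k)) a))"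
    by (subst sum.reindex_bij_betw[OF count_vectors_insert[OF insert.hyps], symmetric])
       (simp add: case_prod_unfold)
  also have "\<dots> = (\<Sum>k\<le>N. \<Sum>x\<in>count_vectors (N - k) A. ?f b k * (\<Prod>a\<in>A. ?f a (x a)))"
  proof (subst sum.Sigma[symmetric])
    have "(\<Prod>a\<in>A. ?f a ((x(b := k)) a)) = (\<Prod>a\<in>A. ?f a (x a))" for x k
      using insert.hyps by (intro prod.cong) auto
    then show "(\<Sum>k\<le>N. \<Sum>x\<in>count_vectors (N - k) A. \<Prod>a\<in>insert b A. ?f a ((x(b := k)) a)) =
        (\<Sum>k\<le>N. \<Sum>x\<in>count_vectors (N - k) A. ?f b k * (\<Prod>a\<in>A. ?f a (x a)))"
      using insert.hyps by simp
  qed (auto simp: finite_count_vectors insert.hyps)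
  also have "\<dots> = (\<Sum>k\<le>N. ?f b k * ((\<Sum>a\<in>A. p a) ^ (N - k) / fact (N - k)))"
    by (simp only: sum_distrib_left[symmetric] insert.IH)
  also have "\<dots> = (\<Sum>k\<le>N. of_nat (N choose k) * p b ^ k * (\<Sum>a\<in>A. p a) ^ (N - k)) / fact N"
    unfolding sum_divide_distrib by (intro sum.cong) (auto simp: binomial_fact)
  also have "\<dots> = (\<Sum>a\<in>insert b A. p a) ^ N / fact N"
    using insert.hyps by (simp add: binomial_ring)
  finally show ?case .
qed

lemma pmf_multinomial_pmf:
  assumes "finite A" "\<And>a. a \<in> A \<Longrightarrow> 0 \<le> p a" "(\<Sum>a\<in>A. p a) = 1"
  shows "pmf (multinomial_pmf N A p) x = multinomial_density N A p x"
  unfolding multinomial_pmf_def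
proof (rule pmf_embed_pmf)
  show nonneg: "0 \<le> multinomial_density N A p x" for x
    using assms by (auto simp: multinomial_density_def intro!: mult_nonneg_nonneg divide_nonneg_nonneg prod_nonneg)
  have "(\<integral>\<^sup>+x. ennreal (multinomial_density N A p x) \<partial>count_space UNIV) =
      (\<Sum>x\<in>count_vectors N A. ennreal (multinomial_density N A p x))"
    using assms(1) by (intro nn_integral_count_space')
      (auto simp: finite_count_vectors multinomial_density_def)
  also have "\<dots> = ennreal (\<Sum>x\<in>count_vectors N A. multinomial_density N A p x)"
    by (rule sum_ennreal) (use nonneg in auto)
  also have "(\<Sum>x\<in>count_vectors N A. multinomial_density N A p x) =
      fact N * (\<Sum>x\<in>count_vectors N A. \<Prod>a\<in>A. p a ^ x a / fact (x a))"
    unfolding sum_distrib_left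
    by (intro sum.cong) (auto simp: multinomial_density_def prod_dividef)
  also have "\<dots> = 1"
    using assms by (simp add: multinomial_theorem)
  finally show "(\<integral>\<^sup>+x. ennreal (multinomial_density N A p x) \<partial>count_space UNIV) = 1"
    by simp
qed

text \<open>
  An array indexed by \<open>i = 0, \<dots>, m\<close> and \<open>j = 0, \<dots>, n\<close> is a function on \<^typ>\<open>nat \<times> nat\<close>
  of which only the values on \<open>cells m n\<close> matter.
\<close>

definition cells :: "nat \<Rightarrow> nat \<Rightarrow> (nat \<times> nat) set" where
  "cells m n = {0..m} \<times> {0..n}"

definition param_space :: "nat \<Rightarrow> nat \<Rightarrow> (nat \<times> nat \<Rightarrow> real) set" where
  "param_space m n =
     {p. (\<forall>i\<in>{0..m}. \<forall>j\<in>{0..n}. 0 < p (i, j)) \<and> (\<Sum>i=0..m. \<Sum>j=0..n. p (i, j)) = 1}"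

lemma pmf_multinomial_pmf_cells:
  assumes "p \<in> param_space m n"
  shows "pmf (multinomial_pmf N (cells m n) p) x = multinomial_density N (cells m n) p x"
  by (rule pmf_multinomial_pmf)
     (use assms in \<open>auto simp: param_space_def cells_def sum.cartesian_product less_imp_le\<close>)

definition row_total :: "nat \<Rightarrow> (nat \<times> nat \<Rightarrow> nat) \<Rightarrow> nat \<Rightarrow> nat" where
  "row_total n x i = (\<Sum>j=0..n. x (i, j))"

text \<open>
  Joint law of \<open>(X, Y)\<close>: the second table \<open>Y\<^sup>*\<close> is independent of \<open>X\<close>, and only its row totals
  are observed.
\<close>

definition obs_law ::
  "nat \<Rightarrow> nat \<Rightarrow> nat \<Rightarrow> nat \<Rightarrow> (nat \<times> nat \<Rightarrow> real) \<Rightarrow> ((nat \<times> nat \<Rightarrow> nat) \<times> (nat \<Rightarrow> nat)) pmf" where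
  "obs_law m n N N' p =
     map_pmf (\<lambda>(x, y_star). (x, row_total n y_star))
       (pair_pmf (multinomial_pmf N (cells m n) p) (multinomial_pmf N' (cells m n) p))"

definition entropy_loss ::
  "nat \<Rightarrow> nat \<Rightarrow> (nat \<times> nat \<Rightarrow> real) \<Rightarrow> (nat \<times> nat \<Rightarrow> real) \<Rightarrow> real" where
  "entropy_loss m n d p = (\<Sum>i=0..m. \<Sum>j=0..n. p (i, j) * ln (p (i, j) / d (i, j)))"

definition p_tilde ::
  "nat \<Rightarrow> nat \<Rightarrow> nat \<Rightarrow> (nat \<times> nat \<Rightarrow> nat) \<times> (nat \<Rightarrow> nat) \<Rightarrow> nat \<times> nat \<Rightarrow> real" where
  "p_tilde m n N = (\<lambda>(x, y) (i, j).
     (real (x (i, j)) + 1 / 2) / (real N + (1 + real m) * (1 + real n) / 2))"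

definition p_hat ::
  "nat \<Rightarrow> nat \<Rightarrow> nat \<Rightarrow> nat \<Rightarrow> (nat \<times> nat \<Rightarrow> nat) \<times> (nat \<Rightarrow> nat) \<Rightarrow> nat \<times> nat \<Rightarrow> real" where
  "p_hat m n N N' = (\<lambda>(x, y) (i, j).
     (real (row_total n x i) + real (y i) + (1 + real n) / 2)
       / (real N + real N' + (1 + real m) * (1 + real n) / 2)
     * ((real (x (i, j)) + 1 / 2) / (real (row_total n x i) + (1 + real n) / 2)))"

definition risk :: "('p \<Rightarrow> 'x pmf) \<Rightarrow> ('d \<Rightarrow> 'p \<Rightarrow> real) \<Rightarrow> ('x \<Rightarrow> 'd) \<Rightarrow> 'p \<Rightarrow> real" where
  "risk law L \<delta> p = measure_pmf.expectation (law p) (\<lambda>x. L (\<delta> x) p)"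

text \<open>\<open>dominated_by \<Theta> law L \<delta> \<delta>'\<close>: the estimator \<open>\<delta>\<close> is dominated by the estimator \<open>\<delta>'\<close>.\<close>

definition dominated_by ::
  "'p set \<Rightarrow> ('p \<Rightarrow> 'x pmf) \<Rightarrow> ('d \<Rightarrow> 'p \<Rightarrow> real) \<Rightarrow> ('x \<Rightarrow> 'd) \<Rightarrow> ('x \<Rightarrow> 'd) \<Rightarrow> bool" where
  "dominated_by \<Theta> law L \<delta> \<delta>' \<longleftrightarrow>
     (\<forall>p\<in>\<Theta>. risk law L \<delta>' p \<le> risk law L \<delta> p) \<and> (\<exists>p\<in>\<Theta>. risk law L \<delta>' p < risk law L \<delta> p)"

end

theory Submission
  imports Defs
begin

text \<open>
  The two estimators differ only in how they estimate the row probabilities \<open>q\<^sub>i\<close>, so the difference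
  of their losses is a difference of two Kullback-Leibler losses for \<open>q\<close>, the first based on \<open>N\<close>
  trials and the second on \<open>N + N'\<close>. Write \<open>a = (1 + n) / 2\<close> and \<open>A = (1 + m) a\<close>.
  Comparison with the chi-square divergence and \<open>E (1 / (Z + 1)) \<le> 1 / ((M + 1) q)\<close> for \<open>Z\<close>
  binomial with \<open>M = N + N'\<close> trials bound the second risk by \<open>(A - 1) / (M + 1)\<close>, uniformly in \<open>q\<close>.
  The first risk is bounded below by the expected Hellinger distance in row \<open>0\<close>: the estimate of
  \<open>q\<^sub>0\<close> takes the distinct values \<open>a / (N + A)\<close> and \<open>(N + a) / (N + A)\<close> with probabilities
  \<open>(1 - q\<^sub>0)\<^sup>N\<close> and \<open>q\<^sub>0\<^sup>N\<close>, so by compactness of \<open>[0, 1]\<close> it exceeds a positive constant.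
\<close>

section \<open>Generating functions of multinomial counts and an inverse moment\<close>

lemma set_pmf_multinomial_subset:
  assumes "finite A" "\<And>a. a \<in> A \<Longrightarrow> 0 \<le> p a" "(\<Sum>a\<in>A. p a) = 1"
  shows "set_pmf (multinomial_pmf N A p) \<subseteq> count_vectors N A"
  using pmf_multinomial_pmf[OF assms, where N = N]
  by (auto simp: set_pmf_eq multinomial_density_def split: if_splits)

lemma finite_set_pmf_multinomial:
  assumes "finite A" "\<And>a. a \<in> A \<Longrightarrow> 0 \<le> p a" "(\<Sum>a\<in>A. p a) = 1"
  shows "finite (set_pmf (multinomial_pmf N A p))"
  using set_pmf_multinomial_subset[OF assms] finite_count_vectors[OF assms(1)]
  by (rule finite_subset)

text \<open>The factor \<open>t ^ (\<Sum>a\<in>B. x a)\<close> is absorbed into the density by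
  replacing the weight \<open>p a\<close> by \<open>p a * t\<close> on \<open>B\<close>; the
  multinomial theorem then sums the reweighted density.\<close>

lemma multinomial_pgf:
  fixes p :: "'a \<Rightarrow> real" and t :: real
  assumes A: "finite A" "\<And>a. a \<in> A \<Longrightarrow> 0 \<le> p a" "(\<Sum>a\<in>A. p a) = 1" and B: "B \<subseteq> A"
  shows "measure_pmf.expectation (multinomial_pmf N A p) (\<lambda>x. t ^ (\<Sum>a\<in>B. x a)) =
    (1 - sum p B + sum p B * t) ^ N"
proof -
  let ?w = "\<lambda>a. p a * (if a \<in> B then t else 1)"
  have weight: "pmf (multinomial_pmf N A p) x * t ^ (\<Sum>a\<in>B. x a) =
      fact N * (\<Prod>a\<in>A. ?w a ^ x a / fact (x a))" if "x \<in> count_vectors N A" for x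
  proof -
    have "t ^ (\<Sum>a\<in>B. x a) = (\<Prod>a\<in>A. if a \<in> B then t ^ x a else 1)"
      using B A(1) by (simp add: power_sum prod.If_cases Int_absorb1)
    also have "\<dots> = (\<Prod>a\<in>A. (if a \<in> B then t else 1) ^ x a)"
      by (intro prod.cong) auto
    finally show ?thesis
      using that pmf_multinomial_pmf[of A p N x] A
      by (simp add: multinomial_density_def power_mult_distrib prod.distrib prod_dividef)
  qed
  have "measure_pmf.expectation (multinomial_pmf N A p) (\<lambda>x. t ^ (\<Sum>a\<in>B. x a)) =
      (\<Sum>x\<in>count_vectors N A. pmf (multinomial_pmf N A p) x * t ^ (\<Sum>a\<in>B. x a))"
    using set_pmf_multinomial_subset[OF A, where N = N] finite_count_vectors[OF A(1)]
    by (subst integral_measure_pmf[where A = "count_vectors N A"]) auto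
  also have "\<dots> = fact N * (\<Sum>x\<in>count_vectors N A. \<Prod>a\<in>A. ?w a ^ x a / fact (x a))"
    by (simp add: weight sum_distrib_left)
  also have "\<dots> = (\<Sum>a\<in>A. ?w a) ^ N"
    using A(1) by (subst multinomial_theorem) auto
  also have "(\<Sum>a\<in>A. ?w a) = (\<Sum>a\<in>A - B. ?w a) + (\<Sum>a\<in>B. ?w a)"
    by (rule sum.subset_diff) (use A B in auto)
  also have "\<dots> = (\<Sum>a\<in>A - B. p a) + sum p B * t"
    by (simp add: sum_distrib_right)
  also have "(\<Sum>a\<in>A - B. p a) = 1 - sum p B"
    using A B by (simp add: sum_diff)
  finally show ?thesis .
qed

lemma expectation_pair_pmf_prod:
  fixes f :: "'a \<Rightarrow> real" and g :: "'b \<Rightarrow> real"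
  assumes "finite (set_pmf P)" "finite (set_pmf Q)"
  shows "measure_pmf.expectation (pair_pmf P Q) (\<lambda>(x, y). f x * g y) =
    measure_pmf.expectation P f * measure_pmf.expectation Q g"
proof -
  have "measure_pmf.expectation (pair_pmf P Q) (\<lambda>(x, y). f x * g y) =
      (\<Sum>(x, y)\<in>set_pmf P \<times> set_pmf Q. (pmf P x * f x) * (pmf Q y * g y))"
    using assms
    by (subst integral_measure_pmf[where A = "set_pmf P \<times> set_pmf Q"])
      (auto simp: pmf_pair mult_ac intro!: sum.cong)
  also have "\<dots> = (\<Sum>x\<in>set_pmf P. pmf P x * f x) * (\<Sum>y\<in>set_pmf Q. pmf Q y * g y)"
    by (simp add: sum_product sum.cartesian_product)
  finally show ?thesis
    using assms
    by (simp add: integral_measure_pmf[where A = "set_pmf P"] integral_measure_pmf[where A = "set_pmf Q"])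
qed

text \<open>
  \<open>F\<close> and \<open>G\<close> below are antiderivatives of the two sides of \<open>pgf\<close>, compared on \<open>[0, 1]\<close>.
\<close>

lemma expectation_inverse_Suc_le:
  fixes Z :: "'a \<Rightarrow> nat" and q :: real
  assumes fin: "finite (set_pmf P)" and q: "0 < q" "q \<le> 1"
    and pgf: "\<And>t. measure_pmf.expectation P (\<lambda>x. t ^ Z x) = (1 - q + q * t) ^ M"
  shows "measure_pmf.expectation P (\<lambda>x. 1 / (real (Z x) + 1)) \<le> 1 / ((real M + 1) * q)"
proof -
  define F where "F t = (\<Sum>x\<in>set_pmf P. pmf P x * (t ^ Suc (Z x) / (real (Z x) + 1)))" for t
  define G where "G t = (1 - q + q * t) ^ Suc M / ((real M + 1) * q)" for t
  have F: "(F has_real_derivative (1 - q + q * t) ^ M) (at t)" for t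
  proof -
    have "((\<lambda>t. t ^ Suc k / (real k + 1)) has_real_derivative t ^ k) (at t)" for k
    proof -
      have "((\<lambda>t. t ^ Suc k) has_real_derivative (real k + 1) * t ^ k) (at t)"
        using DERIV_pow[of "Suc k" t UNIV] by (simp add: add.commute)
      from DERIV_cdivide[OF this, of "real k + 1"] show ?thesis by simp
    qed
    then have "(F has_real_derivative (\<Sum>x\<in>set_pmf P. pmf P x * t ^ Z x)) (at t)"
      unfolding F_def by (intro DERIV_sum DERIV_cmult)
    then show ?thesis
      using pgf[of t] fin by (simp add: integral_measure_pmf[where A = "set_pmf P"])
  qed
  have G: "(G has_real_derivative (1 - q + q * t) ^ M) (at t)" for t
  proof -
    have "((\<lambda>t. (1 - q + q * t) ^ Suc M) has_real_derivative
        (real M + 1) * q * (1 - q + q * t) ^ M) (at t)"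
      by (auto intro!: derivative_eq_intros simp del: power_Suc)
    from DERIV_cdivide[OF this, of "(real M + 1) * q"] show ?thesis
      using q unfolding G_def by simp
  qed
  \<comment> \<open>Equal derivatives make \<open>F - G\<close> constant. The inequality arises only
    from discarding \<open>G 0 \<ge> 0\<close>.\<close>
  have "F 1 - G 1 = F 0 - G 0"
    by (rule DERIV_isconst_all[of "\<lambda>t. F t - G t"]) (auto intro!: derivative_eq_intros F G)
  moreover have "F 0 = 0" "0 \<le> G 0" "G 1 = 1 / ((real M + 1) * q)"
    using q by (auto simp: F_def G_def)
  moreover have "measure_pmf.expectation P (\<lambda>x. 1 / (real (Z x) + 1)) = F 1"
    using fin by (simp add: F_def integral_measure_pmf[where A = "set_pmf P"])
  ultimately show ?thesis by linarith
qed

section \<open>Lower and upper bounds for the Kullback-Leibler divergence\<close>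

text \<open>This is \<open>ln u \<le> u - 1\<close> at \<open>u = sqrt (d i / q i)\<close>,
  multiplied by \<open>2 * q i\<close>. The termwise bound carries an extra
  \<open>q i - d i\<close>, which sums to 0 because both vectors have total mass 1.\<close>

lemma kl_ge_hellinger:
  fixes q d :: "'a \<Rightarrow> real"
  assumes "\<And>i. i \<in> I \<Longrightarrow> 0 < q i" "\<And>i. i \<in> I \<Longrightarrow> 0 < d i" "sum q I = 1" "sum d I = 1"
  shows "(\<Sum>i\<in>I. (sqrt (q i) - sqrt (d i))\<^sup>2) \<le> (\<Sum>i\<in>I. q i * ln (q i / d i))"
proof -
  have "q i - 2 * (sqrt (q i) * sqrt (d i)) + d i + (q i - d i) \<le> q i * ln (q i / d i)" if "i \<in> I" for i
  proof -
    have pos: "0 < q i" "0 < d i" using assms that by auto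
    then have "ln (sqrt (d i / q i)) \<le> sqrt (d i / q i) - 1"
      by (intro ln_le_minus_one) simp
    then have "2 * q i * ln (sqrt (d i / q i)) \<le> 2 * q i * (sqrt (d i / q i) - 1)"
      using pos by (intro mult_left_mono) auto
    also have "q i * sqrt (d i / q i) = sqrt (q i) * sqrt (d i)"
      using pos by (simp add: real_sqrt_divide field_simps flip: power2_eq_square)
    then have "2 * q i * (sqrt (d i / q i) - 1) = 2 * (sqrt (q i) * sqrt (d i)) - 2 * q i"
      by (simp add: algebra_simps)
    also have "2 * q i * ln (sqrt (d i / q i)) = - (q i * ln (q i / d i))"
      using pos by (simp add: ln_sqrt ln_div right_diff_distrib)
    finally show ?thesis
      by (simp add: algebra_simps)
  qed
  then have "(\<Sum>i\<in>I. q i - 2 * (sqrt (q i) * sqrt (d i)) + d i + (q i - d i))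
      \<le> (\<Sum>i\<in>I. q i * ln (q i / d i))"
    by (rule sum_mono)
  moreover have "(\<Sum>i\<in>I. q i - d i) = 0"
    using assms(3,4) by (simp add: sum_subtractf)
  moreover have "(\<Sum>i\<in>I. (sqrt (q i) - sqrt (d i))\<^sup>2) = (\<Sum>i\<in>I. q i - 2 * (sqrt (q i) * sqrt (d i)) + d i)"
    using assms(1,2) by (intro sum.cong) (auto simp: power2_diff less_imp_le)
  ultimately show ?thesis by (simp only: sum.distrib)
qed

text \<open>Here \<open>ln u \<le> u - 1\<close> is used at \<open>u = q i / d i\<close>. When
  \<open>d\<close> has total mass 1, the right side is the chi-square divergence.\<close>

lemma kl_le_chi_square:
  fixes q d :: "'a \<Rightarrow> real"
  assumes "\<And>i. i \<in> I \<Longrightarrow> 0 < q i" "\<And>i. i \<in> I \<Longrightarrow> 0 < d i" "sum q I = 1"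
  shows "(\<Sum>i\<in>I. q i * ln (q i / d i)) \<le> (\<Sum>i\<in>I. (q i)\<^sup>2 / d i) - 1"
proof -
  have "(\<Sum>i\<in>I. q i * ln (q i / d i)) \<le> (\<Sum>i\<in>I. q i * (q i / d i - 1))"
    using assms by (intro sum_mono mult_left_mono ln_le_minus_one) (auto simp: less_imp_le)
  also have "\<dots> = (\<Sum>i\<in>I. (q i)\<^sup>2 / d i) - 1"
    using assms(3) by (simp add: right_diff_distrib sum_subtractf power2_eq_square)
  finally show ?thesis .
qed

text \<open>The expression is continuous on [0, 1], so its minimum is attained, and it has no zero
  there: strictly between 0 and 1 both squares would have to vanish, contradicting
  \<open>l < u\<close>; at 0 and 1 the weight that stays 1 multiplies a nonzero square, since
  \<open>0 < l\<close> and \<open>u < 1\<close>.\<close>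

lemma hellinger_gap:
  fixes l u :: real
  assumes "0 < l" "l < u" "u < 1"
  obtains c where "0 < c"
    "\<And>q. \<lbrakk>0 \<le> q; q \<le> 1\<rbrakk> \<Longrightarrow> c \<le> (1 - q) ^ N * (sqrt q - sqrt l)\<^sup>2 + q ^ N * (sqrt q - sqrt u)\<^sup>2"
proof -
  let ?g = "\<lambda>q. (1 - q) ^ N * (sqrt q - sqrt l)\<^sup>2 + q ^ N * (sqrt q - sqrt u)\<^sup>2"
  have "continuous_on {0..1} ?g" by (intro continuous_intros)
  from continuous_attains_inf[OF compact_Icc _ this]
  obtain z where z: "z \<in> {0..1}" "\<And>q. q \<in> {0..1} \<Longrightarrow> ?g z \<le> ?g q" by auto
  have "?g z \<noteq> 0"
  proof
    assume "?g z = 0"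
    moreover have "0 \<le> (1 - z) ^ N * (sqrt z - sqrt l)\<^sup>2" "0 \<le> z ^ N * (sqrt z - sqrt u)\<^sup>2"
      using z(1) by auto
    ultimately have "(1 - z) ^ N * (sqrt z - sqrt l)\<^sup>2 = 0" "z ^ N * (sqrt z - sqrt u)\<^sup>2 = 0"
      by linarith+
    then show False using assms by (auto split: if_splits)
  qed
  moreover have "0 \<le> ?g z" using z(1) by auto
  ultimately have "0 < ?g z" by linarith
  then show ?thesis using z(2) by (intro that[of "?g z"]) auto
qed

section \<open>Row totals of a multinomial table\<close>

lemma finite_cells: "finite (cells m n)"
  by (simp add: cells_def)

text \<open>A row becomes a set of cells, the form of \<open>B\<close> in
  \<open>multinomial_pgf\<close>.\<close>

lemma row_total_eq: "row_total n x i = sum x ({i} \<times> {0..n})"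
proof -
  have "(\<Sum>j=0..n. x (i, j)) = (\<Sum>k\<in>{i}. \<Sum>j=0..n. x (k, j))" by simp
  also have "\<dots> = sum x ({i} \<times> {0..n})" by (subst sum.cartesian_product) simp
  finally show ?thesis by (simp add: row_total_def)
qed

lemma param_spaceD:
  assumes "p \<in> param_space m n"
  shows "\<And>a. a \<in> cells m n \<Longrightarrow> 0 < p a" "\<And>a. a \<in> cells m n \<Longrightarrow> 0 \<le> p a" "sum p (cells m n) = 1"
  using assms by (auto simp: param_space_def cells_def sum.cartesian_product less_imp_le)

lemma finite_set_pmf_multinomial_cells:
  "p \<in> param_space m n \<Longrightarrow> finite (set_pmf (multinomial_pmf N (cells m n) p))"
  by (rule finite_set_pmf_multinomial) (auto simp: finite_cells param_spaceD)

lemma row_total_sum: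
  assumes "x \<in> count_vectors N (cells m n)"
  shows "(\<Sum>i=0..m. row_total n x i) = N"
  using assms by (simp add: row_total_def count_vectors_def cells_def sum.cartesian_product)

lemma row_total_pgf:
  fixes t :: real
  assumes "p \<in> param_space m n" "i \<le> m"
  shows "measure_pmf.expectation (multinomial_pmf N (cells m n) p) (\<lambda>x. t ^ row_total n x i) =
    (1 - (\<Sum>j=0..n. p (i, j)) + (\<Sum>j=0..n. p (i, j)) * t) ^ N"
proof -
  have "sum p ({i} \<times> {0..n}) = (\<Sum>k\<in>{i}. \<Sum>j=0..n. p (k, j))"
    by (subst sum.cartesian_product) simp
  then show ?thesis
    unfolding row_total_eq using assms
    by (subst multinomial_pgf) (auto simp: finite_cells param_spaceD, auto simp: cells_def)
qed

lemma risk_obs_law: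
  "risk (obs_law m n N N') L \<delta> p = measure_pmf.expectation
     (pair_pmf (multinomial_pmf N (cells m n) p) (multinomial_pmf N' (cells m n) p))
     (\<lambda>(x, y). L (\<delta> (x, row_total n y)) p)"
  by (simp add: risk_def obs_law_def case_prod_unfold)

section \<open>Comparison of the losses for fixed observations\<close>

lemma loss_difference:
  fixes p :: "nat \<times> nat \<Rightarrow> real"
  assumes p: "p \<in> param_space m n"
  defines "q \<equiv> \<lambda>i. \<Sum>j=0..n. p (i, j)"
  defines "a \<equiv> (1 + real n) / 2"
  shows "entropy_loss m n (p_tilde m n N (x, y)) p - entropy_loss m n (p_hat m n N N' (x, y)) p =
    (\<Sum>i=0..m. q i * ln (q i / ((real (row_total n x i) + a) / (real N + (1 + real m) * a)))) -
    (\<Sum>i=0..m. q i * ln (q i / ((real (row_total n x i) + real (y i) + a) /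
      (real N + real N' + (1 + real m) * a))))"
proof -
  let ?T = "\<lambda>i. (real (row_total n x i) + a) / (real N + (1 + real m) * a)"
  let ?H = "\<lambda>i. (real (row_total n x i) + real (y i) + a) / (real N + real N' + (1 + real m) * a)"
  have a: "0 < a" by (simp add: a_def)
  then have "0 < (1 + real m) * a" by (intro mult_pos_pos) auto
  with a have TH: "0 < ?T i" "0 < ?H i" for i
    by (auto intro!: divide_pos_pos add_nonneg_pos)
  have q: "0 < q i" if "i \<le> m" for i
    using p that unfolding q_def param_space_def by (intro sum_pos) auto
  have cell: "p (i, j) * ln (p (i, j) / p_tilde m n N (x, y) (i, j))
      - p (i, j) * ln (p (i, j) / p_hat m n N N' (x, y) (i, j)) = p (i, j) * (ln (?H i) - ln (?T i))"
    if "i \<le> m" "j \<le> n" for i j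
  proof -
    have pij: "0 < p (i, j)" using p that by (auto simp: param_space_def)
    \<comment> \<open>\<open>e\<close> is the estimate of the conditional probability of column
      \<open>j\<close> within row \<open>i\<close>. Both estimators are a row estimate times
      \<open>e\<close>, so it cancels from the difference of logarithms.\<close>
    define e where "e = (real (x (i, j)) + 1 / 2) / (real (row_total n x i) + a)"
    have e: "0 < e" unfolding e_def using a by (intro divide_pos_pos) auto
    have "p_hat m n N N' (x, y) (i, j) = ?H i * e"
      by (simp add: p_hat_def e_def a_def)
    moreover have "real (row_total n x i) + a \<noteq> 0" using a by linarith
    then have "p_tilde m n N (x, y) (i, j) = ?T i * e"
      by (simp add: p_tilde_def e_def) (simp add: a_def)
    ultimately show ?thesis
      using TH[of i] e pij by (simp only: ln_divide_pos ln_mult_pos mult_pos_pos) (simp add: algebra_simps)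
  qed
  have "entropy_loss m n (p_tilde m n N (x, y)) p - entropy_loss m n (p_hat m n N N' (x, y)) p =
      (\<Sum>i=0..m. \<Sum>j=0..n. p (i, j) * (ln (?H i) - ln (?T i)))"
    unfolding entropy_loss_def sum_subtractf[symmetric] by (intro sum.cong) (simp_all add: cell)
  also have "\<dots> = (\<Sum>i=0..m. q i * (ln (?H i) - ln (?T i)))"
    by (simp add: q_def sum_distrib_right)
  also have "\<dots> = (\<Sum>i=0..m. q i * ln (q i / ?T i) - q i * ln (q i / ?H i))"
  proof (intro sum.cong refl)
    fix i assume "i \<in> {0..m}"
    then have "0 < q i" by (simp add: q)
    then show "q i * (ln (?H i) - ln (?T i)) = q i * ln (q i / ?T i) - q i * ln (q i / ?H i)"
      using TH[of i] by (simp only: ln_divide_pos) (simp add: algebra_simps)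
  qed
  finally show ?thesis by (simp add: sum_subtractf)
qed

text \<open>
  The powers of \<open>0\<close> are the indicators of the two extreme values of the total of row \<open>0\<close>, written so
  that their expectations are values at \<open>0\<close> of probability generating functions.
\<close>

lemma loss_difference_ge:
  fixes p :: "nat \<times> nat \<Rightarrow> real"
  assumes p: "p \<in> param_space m n" and "1 \<le> n" "1 \<le> N" and x: "x \<in> count_vectors N (cells m n)"
  defines "q \<equiv> \<lambda>i. \<Sum>j=0..n. p (i, j)"
  defines "a \<equiv> (1 + real n) / 2"
  defines "A \<equiv> (1 + real m) * a"
  shows "0 ^ row_total n x 0 * (sqrt (q 0) - sqrt (a / (real N + A)))\<^sup>2
    + 0 ^ (\<Sum>b\<in>cells m n - {0} \<times> {0..n}. x b) * (sqrt (q 0) - sqrt ((real N + a) / (real N + A)))\<^sup>2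
    - ((\<Sum>i=0..m. (q i)\<^sup>2 * (real N + real N' + A) * (1 / (real (row_total n x i + y i) + 1))) - 1)
    \<le> entropy_loss m n (p_tilde m n N (x, y)) p - entropy_loss m n (p_hat m n N N' (x, y)) p"
proof -
  let ?r = "row_total n x"
  let ?T = "\<lambda>i. (real (?r i) + a) / (real N + A)"
  let ?H = "\<lambda>i. (real (?r i) + real (y i) + a) / (real N + real N' + A)"
  have a: "1 \<le> a" and A: "0 < A" using \<open>1 \<le> n\<close> by (auto simp: a_def A_def)
  then have TH: "0 < ?T i" "0 < ?H i" for i
    by (auto intro!: divide_pos_pos)
  have q: "0 < q i" if "i \<in> {0..m}" for i
    using p that unfolding q_def param_space_def by (intro sum_pos) auto
  have q1: "sum q {0..m} = 1" using p by (simp add: q_def param_space_def)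
  have "(\<Sum>i=0..m. real (?r i) + a) = real N + A"
    using row_total_sum[OF x] by (simp add: sum.distrib A_def flip: of_nat_sum)
  then have T1: "sum ?T {0..m} = 1"
    using A by (simp flip: sum_divide_distrib)
  \<comment> \<open>The count outside row 0; it vanishes exactly when row 0 holds all
    \<open>N\<close> observations.\<close>
  define s where "s = (\<Sum>b\<in>cells m n - {0} \<times> {0..n}. x b)"
  have "sum x (cells m n) = s + sum x ({0} \<times> {0..n})"
    unfolding s_def by (rule sum.subset_diff) (auto simp: cells_def)
  then have rs: "?r 0 + s = N"
    using x by (simp add: row_total_eq count_vectors_def)
  have "0 ^ ?r 0 * (sqrt (q 0) - sqrt (a / (real N + A)))\<^sup>2
      + 0 ^ s * (sqrt (q 0) - sqrt ((real N + a) / (real N + A)))\<^sup>2 \<le> (sqrt (q 0) - sqrt (?T 0))\<^sup>2"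
  proof -
    \<comment> \<open>As \<open>N \<ge> 1\<close>, at most one power of 0 equals 1, and the estimate
      in its square is then exactly \<open>?T 0\<close>. For intermediate totals the left side is
      0.\<close>
    consider "?r 0 = 0" "s = N" | "?r 0 = N" "s = 0" | "0 < ?r 0" "0 < s" using rs by linarith
    then show ?thesis using \<open>1 \<le> N\<close> by cases (auto simp: zero_power)
  qed
  also have "\<dots> \<le> (\<Sum>i=0..m. (sqrt (q i) - sqrt (?T i))\<^sup>2)"
    by (rule member_le_sum) auto
  also have "\<dots> \<le> (\<Sum>i=0..m. q i * ln (q i / ?T i))"
    by (rule kl_ge_hellinger) (use q TH q1 T1 in auto)
  finally have lower: "0 ^ ?r 0 * (sqrt (q 0) - sqrt (a / (real N + A)))\<^sup>2
      + 0 ^ s * (sqrt (q 0) - sqrt ((real N + a) / (real N + A)))\<^sup>2 \<le> (\<Sum>i=0..m. q i * ln (q i / ?T i))" .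
  have "(\<Sum>i=0..m. q i * ln (q i / ?H i)) \<le> (\<Sum>i=0..m. (q i)\<^sup>2 / ?H i) - 1"
    by (rule kl_le_chi_square) (use q TH q1 in auto)
  moreover have "(\<Sum>i=0..m. (q i)\<^sup>2 / ?H i) \<le>
      (\<Sum>i=0..m. (q i)\<^sup>2 * (real N + real N' + A) * (1 / (real (?r i + y i) + 1)))"
  proof (intro sum_mono)
    fix i
    have "(q i)\<^sup>2 / ?H i = (q i)\<^sup>2 * (real N + real N' + A) * (1 / (real (?r i) + real (y i) + a))"
      by simp
    \<comment> \<open>Since \<open>n \<ge> 1\<close> gives \<open>a \<ge> 1\<close>, lowering
      \<open>a\<close> to 1 in the denominator yields the reciprocal bounded by
      \<open>expectation_inverse_Suc_le\<close>.\<close>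
    also have "\<dots> \<le> (q i)\<^sup>2 * (real N + real N' + A) * (1 / (real (?r i + y i) + 1))"
      using a A by (intro mult_left_mono frac_le) auto
    finally show "(q i)\<^sup>2 / ?H i \<le> (q i)\<^sup>2 * (real N + real N' + A) * (1 / (real (?r i + y i) + 1))" .
  qed
  ultimately show ?thesis
    using lower loss_difference[OF p, of N x y N']
    unfolding s_def q_def A_def a_def by linarith
qed

section \<open>Comparison of the risks\<close>

text \<open>Obtained by taking expectations in \<open>loss_difference_ge\<close>. The bound depends
  on \<open>p\<close> only through the probability \<open>q\<close> of row 0, and on
  \<open>N'\<close> only through the last term.\<close>

lemma risk_difference_ge:
  fixes p :: "nat \<times> nat \<Rightarrow> real"
  assumes p: "p \<in> param_space m n" and n: "1 \<le> n" and N: "1 \<le> N"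
  defines "q \<equiv> \<Sum>j=0..n. p (0, j)"
  defines "a \<equiv> (1 + real n) / 2"
  defines "A \<equiv> (1 + real m) * a"
  shows "(1 - q) ^ N * (sqrt q - sqrt (a / (real N + A)))\<^sup>2
    + q ^ N * (sqrt q - sqrt ((real N + a) / (real N + A)))\<^sup>2 - (A - 1) / (real N + real N' + 1)
    \<le> risk (obs_law m n N N') (entropy_loss m n) (p_tilde m n N) p
      - risk (obs_law m n N N') (entropy_loss m n) (p_hat m n N N') p"
proof -
  let ?X = "multinomial_pmf N (cells m n) p"
  let ?Y = "multinomial_pmf N' (cells m n) p"
  let ?P = "pair_pmf ?X ?Y"
  let ?c0 = "(sqrt q - sqrt (a / (real N + A)))\<^sup>2"
  let ?c1 = "(sqrt q - sqrt ((real N + a) / (real N + A)))\<^sup>2"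
  let ?B = "cells m n - {0} \<times> {0..n}"
  let ?M = "real N + real N'"
  define Q where "Q i = (\<Sum>j=0..n. p (i, j))" for i
  define Z where "Z i xy = row_total n (fst xy) i + row_total n (snd xy) i"
    for i and xy :: "(nat \<times> nat \<Rightarrow> nat) \<times> (nat \<times> nat \<Rightarrow> nat)"
  have finX: "finite (set_pmf ?X)" and finY: "finite (set_pmf ?Y)"
    using p by (auto intro: finite_set_pmf_multinomial_cells)
  then have int: "integrable ?P f" for f :: "_ \<Rightarrow> real"
    by (intro integrable_measure_pmf_finite) auto
  have A: "0 < A" using n by (auto simp: A_def a_def)
  have Q: "0 < Q i" if "i \<in> {0..m}" for i
    using p that unfolding Q_def param_space_def by (intro sum_pos) auto
  have Q1: "sum Q {0..m} = 1" using p by (simp add: Q_def param_space_def)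
  have Qle: "Q i \<le> 1" if "i \<in> {0..m}" for i
    using member_le_sum[of i "{0..m}" Q] that Q Q1 by (auto simp: less_imp_le)
  have fstE: "measure_pmf.expectation ?P (\<lambda>xy. f (fst xy)) = measure_pmf.expectation ?X f"
    for f :: "_ \<Rightarrow> real"
    using integral_map_pmf[of fst ?P f] by (simp add: map_fst_pair_pmf)
  have E0: "measure_pmf.expectation ?P (\<lambda>xy. 0 ^ row_total n (fst xy) 0) = (1 - q) ^ N"
    using row_total_pgf[OF p, of 0 N 0] by (simp add: fstE[of "\<lambda>x. 0 ^ row_total n x 0"] q_def)
  have "sum p (cells m n) = sum p ?B + sum p ({0} \<times> {0..n})"
    by (rule sum.subset_diff) (auto simp: cells_def)
  moreover have "sum p ({0} \<times> {0..n}) = (\<Sum>k\<in>{0}. \<Sum>j=0..n. p (k, j))"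
    by (subst sum.cartesian_product) simp
  \<comment> \<open>The cells outside row 0 have mass \<open>1 - q\<close>, so all of them are empty
    with probability \<open>q ^ N\<close>.\<close>
  ultimately have pB: "sum p ?B = 1 - q"
    using p by (simp add: param_spaceD q_def)
  have E1: "measure_pmf.expectation ?P (\<lambda>xy. 0 ^ (\<Sum>b\<in>?B. fst xy b)) = q ^ N"
    using multinomial_pgf[of "cells m n" p ?B N 0] p
    by (simp add: fstE[of "\<lambda>x. 0 ^ (\<Sum>b\<in>?B. x b)"] finite_cells param_spaceD pB)
  have EZ: "measure_pmf.expectation ?P (\<lambda>xy. 1 / (real (Z i xy) + 1)) \<le> 1 / ((?M + 1) * Q i)"
    if "i \<in> {0..m}" for i
  proof -
    \<comment> \<open>By independence the two generating functions multiply, so the pooled row total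
      is binomial with \<open>N + N'\<close> trials.\<close>
    have "measure_pmf.expectation ?P (\<lambda>xy. t ^ Z i xy) = (1 - Q i + Q i * t) ^ (N + N')" for t
      using expectation_pair_pmf_prod[OF finX finY, of "\<lambda>x. t ^ row_total n x i" "\<lambda>y. t ^ row_total n y i"]
        row_total_pgf[OF p, of i _ t] that
      by (simp add: Z_def Q_def power_add case_prod_unfold)
    from expectation_inverse_Suc_le[OF _ Q[OF that] Qle[OF that] this] finX finY show ?thesis
      by simp
  qed
  have linear: "measure_pmf.expectation ?P (\<lambda>xy. f xy * c + g xy * d - ((\<Sum>i=0..m. w i * h i xy) - 1)) =
      measure_pmf.expectation ?P f * c + measure_pmf.expectation ?P g * d
      - ((\<Sum>i=0..m. w i * measure_pmf.expectation ?P (h i)) - 1)"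
    for f g :: "_ \<Rightarrow> real" and h w c d
    by (simp add: int)
  have "measure_pmf.expectation ?P (\<lambda>xy. 0 ^ row_total n (fst xy) 0 * ?c0 + 0 ^ (\<Sum>b\<in>?B. fst xy b) * ?c1
      - ((\<Sum>i=0..m. (Q i)\<^sup>2 * (?M + A) * (1 / (real (Z i xy) + 1))) - 1))
    = (1 - q) ^ N * ?c0 + q ^ N * ?c1
      - ((\<Sum>i=0..m. (Q i)\<^sup>2 * (?M + A) * measure_pmf.expectation ?P (\<lambda>xy. 1 / (real (Z i xy) + 1))) - 1)"
    by (subst linear) (simp only: E0 E1)
  moreover have "(\<Sum>i=0..m. (Q i)\<^sup>2 * (?M + A) * measure_pmf.expectation ?P (\<lambda>xy. 1 / (real (Z i xy) + 1)))
      \<le> (\<Sum>i=0..m. Q i * ((?M + A) / (?M + 1)))"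
  proof (intro sum_mono)
    fix i assume i: "i \<in> {0..m}"
    have "(Q i)\<^sup>2 * (?M + A) * measure_pmf.expectation ?P (\<lambda>xy. 1 / (real (Z i xy) + 1))
        \<le> (Q i)\<^sup>2 * (?M + A) * (1 / ((?M + 1) * Q i))"
      using A by (intro mult_left_mono EZ[OF i]) auto
    \<comment> \<open>One factor \<open>Q i\<close> cancels; as the row probabilities sum to 1, the
      total no longer depends on \<open>p\<close>.\<close>
    also have "\<dots> = Q i * ((?M + A) / (?M + 1))"
      using Q[OF i] by (simp add: power2_eq_square)
    finally show "(Q i)\<^sup>2 * (?M + A) * measure_pmf.expectation ?P (\<lambda>xy. 1 / (real (Z i xy) + 1))
        \<le> Q i * ((?M + A) / (?M + 1))" .
  qed
  moreover have "(\<Sum>i=0..m. Q i * ((?M + A) / (?M + 1))) = 1 + (A - 1) / (?M + 1)"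
    unfolding sum_distrib_right[symmetric] Q1 by (simp add: field_simps)
  ultimately have "(1 - q) ^ N * ?c0 + q ^ N * ?c1 - (A - 1) / (?M + 1) \<le>
      measure_pmf.expectation ?P (\<lambda>xy. 0 ^ row_total n (fst xy) 0 * ?c0 + 0 ^ (\<Sum>b\<in>?B. fst xy b) * ?c1
      - ((\<Sum>i=0..m. (Q i)\<^sup>2 * (?M + A) * (1 / (real (Z i xy) + 1))) - 1))"
    by linarith
  also have "\<dots> \<le> measure_pmf.expectation ?P (\<lambda>(x, y).
      entropy_loss m n (p_tilde m n N (x, row_total n y)) p
      - entropy_loss m n (p_hat m n N N' (x, row_total n y)) p)"
  proof (intro integral_mono_AE int AE_pmfI)
    fix xy assume "xy \<in> set_pmf ?P"
    moreover obtain x y where xy: "xy = (x, y)" by (cases xy)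
    ultimately have "x \<in> set_pmf ?X" by simp
    moreover have "set_pmf ?X \<subseteq> count_vectors N (cells m n)"
      using p by (intro set_pmf_multinomial_subset) (auto simp: finite_cells param_spaceD)
    ultimately have "x \<in> count_vectors N (cells m n)" by blast
    from loss_difference_ge[OF p n N this, of N' "row_total n y"]
    show "0 ^ row_total n (fst xy) 0 * ?c0 + 0 ^ (\<Sum>b\<in>?B. fst xy b) * ?c1
      - ((\<Sum>i=0..m. (Q i)\<^sup>2 * (?M + A) * (1 / (real (Z i xy) + 1))) - 1)
      \<le> (case xy of (x, y) \<Rightarrow> entropy_loss m n (p_tilde m n N (x, row_total n y)) p
        - entropy_loss m n (p_hat m n N N' (x, row_total n y)) p)"
      by (simp add: xy Z_def Q_def q_def a_def A_def)
  qed
  also have "\<dots> = risk (obs_law m n N N') (entropy_loss m n) (p_tilde m n N) p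
      - risk (obs_law m n N N') (entropy_loss m n) (p_hat m n N N') p"
    unfolding risk_obs_law case_prod_unfold by (rule Bochner_Integration.integral_diff[OF int int])
  finally show ?thesis .
qed

section \<open>Dominance for large \<open>N'\<close>\<close>

text \<open>The uniform table is a parameter at which the strict inequality required by dominance
  can be asserted.\<close>

lemma param_space_nonempty: "param_space m n \<noteq> {}"
proof -
  have "(\<lambda>_. 1 / ((1 + real m) * (1 + real n))) \<in> param_space m n"
    by (simp add: param_space_def add_pos_nonneg)
  then show ?thesis by blast
qed

theorem theorem2p1:
  fixes m n N :: nat
  assumes "m \<ge> 1" and "n \<ge> 3" and "N \<ge> 1"
  shows "\<exists>N0' \<ge> 1. \<forall>N' \<ge> N0'.
    dominated_by (param_space m n) (obs_law m n N N') (entropy_loss m n)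
      (p_tilde m n N) (p_hat m n N N')"
proof -
  define a where "a = (1 + real n) / 2"
  define A where "A = (1 + real m) * a"
  have a: "0 < a" by (simp add: a_def)
  \<comment> \<open>There are at least two rows, so \<open>a < A\<close>, which keeps the largest
    estimate of a row probability below 1.\<close>
  have "2 * a \<le> A" unfolding A_def using assms(1) a by (intro mult_right_mono) auto
  with a have "0 < a / (real N + A)" "a / (real N + A) < (real N + a) / (real N + A)"
    "(real N + a) / (real N + A) < 1"
    using assms(3) by (auto intro: divide_strict_right_mono)
  from hellinger_gap[OF this, of N] obtain c where c: "0 < c"
    "\<And>q. \<lbrakk>0 \<le> q; q \<le> 1\<rbrakk> \<Longrightarrow> c \<le> (1 - q) ^ N * (sqrt q - sqrt (a / (real N + A)))\<^sup>2
      + q ^ N * (sqrt q - sqrt ((real N + a) / (real N + A)))\<^sup>2"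
    by blast
  \<comment> \<open>The constant \<open>c\<close> is fixed before any \<open>p\<close> or
    \<open>N'\<close>, hence so is \<open>K\<close>. For \<open>N' \<ge> K\<close> the bound on the
    second risk falls below \<open>c\<close>, uniformly in \<open>p\<close>; the threshold
    \<open>Suc K\<close> is also at least 1.\<close>
  obtain K :: nat where K: "\<bar>A - 1\<bar> / c < real K" using reals_Archimedean2 by blast
  have "dominated_by (param_space m n) (obs_law m n N N') (entropy_loss m n)
      (p_tilde m n N) (p_hat m n N N')" if "Suc K \<le> N'" for N'
  proof -
    have "A - 1 < c * real K" using K c(1) by (simp add: field_simps)
    also have "\<dots> \<le> c * (real N + real N' + 1)" using c(1) that by (intro mult_left_mono) auto
    finally have small: "(A - 1) / (real N + real N' + 1) < c"
      by (simp add: divide_less_eq)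
    have "risk (obs_law m n N N') (entropy_loss m n) (p_hat m n N N') p
      < risk (obs_law m n N N') (entropy_loss m n) (p_tilde m n N) p" if p: "p \<in> param_space m n" for p
    proof -
      let ?q = "\<Sum>j=0..n. p (0, j)"
      have pos: "0 \<le> (\<Sum>j=0..n. p (i, j))" if "i \<in> {0..m}" for i
        using p that by (intro sum_nonneg) (auto simp: param_space_def less_imp_le)
      then have "?q \<le> (\<Sum>i=0..m. \<Sum>j=0..n. p (i, j))"
        by (intro member_le_sum[of 0 "{0..m}" "\<lambda>i. \<Sum>j=0..n. p (i, j)"]) auto
      then have "?q \<le> 1" using p by (simp add: param_space_def)
      from c(2)[OF pos this] small risk_difference_ge[OF p, of N N'] assms
      show ?thesis unfolding A_def a_def by simp
    qed
    then show ?thesis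
      using param_space_nonempty[of m n] unfolding dominated_by_def by (blast intro: less_imp_le)
  qed
  then show ?thesis by (intro exI[of _ "Suc K"]) auto
qed

end
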